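(* Let $\Gamma$ be a discrete cocompact subgroup of $\mathrm{PSU}(1,1)$, acting on the open unit disk $\mathbb{D}$. There exists a smooth function $\varphi$ on $\mathbb{D}$ such that (1) $0\le\varphi\le1$; (2) for each $z\in\mathbb{D}$ there are a neighborhood $U$ of $z$ and a finite subset $S$ of $\Gamma$ such that $\varphi=0$ on $\gamma(U)$ for every $\gamma\in\Gamma-S$; (3) $\sum_{\gamma\in\Gamma}\varphi(\gamma(z))=1$ for all $z\in\mathbb{D}$.
   Context: $\mathrm{PSU}(1,1)=\mathrm{SU}(1,1)/\{\pm\mathrm{Id}\}$ acts on $\mathbb{D}$ by $\gamma(z)=\frac{az+b}{\bar bz+\bar a}$, $|a|^2-|b|^2=1$; it is the group of orientation preserving isometries of the Poincaré disk. *)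

theory Defs
  imports "HOL-Analysis.Analysis" "HOL-Algebra.Coset"
begin

section \<open>Smooth functions on open sets\<close>

text \<open>
  On an open set \<^term>\<open>S\<close> of a Euclidean space, \<open>f\<close> is of class $C^{k+1}$ iff it is
  differentiable and all its directional derivatives are of class $C^k$.  Only meant for open
  \<^term>\<open>S\<close>, since the derivatives are the unrestricted ones.
\<close>

primrec cont_diff_on ::
  "nat \<Rightarrow> 'a::euclidean_space set \<Rightarrow> ('a \<Rightarrow> 'b::real_normed_vector) \<Rightarrow> bool" where
  "cont_diff_on 0 S f \<longleftrightarrow> continuous_on S f"
| "cont_diff_on (Suc k) S f \<longleftrightarrow>
     (\<forall>x\<in>S. f differentiable at x) \<and>
     (\<forall>v. cont_diff_on k S (\<lambda>x. frechet_derivative f (at x) v))"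

definition smooth_on :: "'a::euclidean_space set \<Rightarrow> ('a \<Rightarrow> 'b::real_normed_vector) \<Rightarrow> bool" where
  "smooth_on S f \<longleftrightarrow> (\<forall>k. cont_diff_on k S f)"


section \<open>The quotient topology\<close>

definition quotient_topology :: "'a topology \<Rightarrow> ('a \<Rightarrow> 'b) \<Rightarrow> 'b topology" where
  "quotient_topology X f =
     topology (\<lambda>U. U \<subseteq> f ` topspace X \<and> openin X {x \<in> topspace X. f x \<in> U})"

lemma openin_quotient_topology:
  "openin (quotient_topology X f) U \<longleftrightarrow>
     U \<subseteq> f ` topspace X \<and> openin X {x \<in> topspace X. f x \<in> U}"
proof -
  have "istopology (\<lambda>U. U \<subseteq> f ` topspace X \<and> openin X {x \<in> topspace X. f x \<in> U})"
    unfolding istopology_def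
  proof (intro conjI allI impI)
    fix S T
    assume S: "S \<subseteq> f ` topspace X \<and> openin X {x \<in> topspace X. f x \<in> S}"
      and T: "T \<subseteq> f ` topspace X \<and> openin X {x \<in> topspace X. f x \<in> T}"
    show "S \<inter> T \<subseteq> f ` topspace X" using S by blast
    have "{x \<in> topspace X. f x \<in> S \<inter> T} =
          {x \<in> topspace X. f x \<in> S} \<inter> {x \<in> topspace X. f x \<in> T}" by blast
    then show "openin X {x \<in> topspace X. f x \<in> S \<inter> T}" using S T by (simp add: openin_Int)
  next
    fix \<K>
    assume K: "\<forall>K\<in>\<K>. K \<subseteq> f ` topspace X \<and> openin X {x \<in> topspace X. f x \<in> K}"
    show "\<Union>\<K> \<subseteq> f ` topspace X" using K by blast
    have "{x \<in> topspace X. f x \<in> \<Union>\<K>} = (\<Union>K\<in>\<K>. {x \<in> topspace X. f x \<in> K})" by blast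
    then show "openin X {x \<in> topspace X. f x \<in> \<Union>\<K>}" using K by auto
  qed
  then show ?thesis by (simp add: quotient_topology_def)
qed

lemma topspace_quotient_topology [simp]:
  "topspace (quotient_topology X f) = f ` topspace X"
proof
  show "topspace (quotient_topology X f) \<subseteq> f ` topspace X"
    using openin_quotient_topology [of X f] openin_topspace by blast
  have "{x \<in> topspace X. f x \<in> f ` topspace X} = topspace X" by blast
  then have "openin (quotient_topology X f) (f ` topspace X)"
    by (simp add: openin_quotient_topology)
  then show "f ` topspace X \<subseteq> topspace (quotient_topology X f)"
    by (rule openin_subset)
qed

lemma quotient_map_quotient_topology: "quotient_map X (quotient_topology X f) f"
  by (auto simp: quotient_map_def openin_quotient_topology)


section \<open>The groups SU(1,1) and PSU(1,1)\<close>

definition su11_mat :: "complex \<Rightarrow> complex \<Rightarrow> complex^2^2" where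
  "su11_mat a b = vector [vector [a, b], vector [cnj b, cnj a]]"

definition SU11 :: "(complex^2^2) monoid" where
  "SU11 = \<lparr> carrier = {su11_mat a b | a b. (cmod a)\<^sup>2 - (cmod b)\<^sup>2 = 1},
            mult = (**), one = mat 1 \<rparr>"

definition SU11_centre :: "(complex^2^2) set" where
  "SU11_centre = {mat 1, - mat 1}"

definition PSU11 :: "(complex^2^2) set monoid" where
  "PSU11 = SU11 Mod SU11_centre"

definition PSU11_topology :: "(complex^2^2) set topology" where
  "PSU11_topology =
     quotient_topology (top_of_set (carrier SU11)) (\<lambda>A. SU11_centre #>\<^bsub>SU11\<^esub> A)"

lemma su11_mat_nth [simp]:
  "su11_mat a b $ 1 $ 1 = a" "su11_mat a b $ 1 $ 2 = b"
  "su11_mat a b $ 2 $ 1 = cnj b" "su11_mat a b $ 2 $ 2 = cnj a"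
  by (simp_all add: su11_mat_def)

lemma su11_mat_eq_iff: "A = su11_mat a b \<longleftrightarrow>
    A $ 1 $ 1 = a \<and> A $ 1 $ 2 = b \<and> A $ 2 $ 1 = cnj b \<and> A $ 2 $ 2 = cnj a"
  by (auto simp: vec_eq_iff forall_2)

lemma su11_mat_mult:
  "su11_mat a b ** su11_mat c d = su11_mat (a * c + b * cnj d) (a * d + b * cnj c)"
  by (simp add: su11_mat_eq_iff matrix_matrix_mult_def sum_2 mult.commute add.commute)

lemma su11_mat_one: "mat 1 = su11_mat 1 0"
  by (simp add: su11_mat_eq_iff mat_def)

lemma su11_mat_uminus: "- su11_mat a b = su11_mat (- a) (- b)"
  by (simp add: su11_mat_eq_iff)

lemma su11_cond_iff: "(cmod a)\<^sup>2 - (cmod b)\<^sup>2 = 1 \<longleftrightarrow> a * cnj a - b * cnj b = 1"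
proof -
  have "a * cnj a - b * cnj b = complex_of_real ((cmod a)\<^sup>2 - (cmod b)\<^sup>2)"
    by (simp add: complex_norm_square del: of_real_power)
  then show ?thesis by (metis of_real_eq_1_iff)
qed

lemma carrier_SU11_iff:
  "A \<in> carrier SU11 \<longleftrightarrow> (\<exists>a b. A = su11_mat a b \<and> a * cnj a - b * cnj b = 1)"
  by (auto simp: SU11_def su11_cond_iff)

lemma SU11_simps [simp]: "mult SU11 = (**)" "one SU11 = mat 1"
  by (simp_all add: SU11_def)

lemma group_SU11: "group SU11"
proof (rule groupI)
  fix A B assume "A \<in> carrier SU11" "B \<in> carrier SU11"
  then obtain a b c d where *: "A = su11_mat a b" "a * cnj a - b * cnj b = 1"
      "B = su11_mat c d" "c * cnj c - d * cnj d = 1"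
    by (auto simp: carrier_SU11_iff)
  have "(a * c + b * cnj d) * cnj (a * c + b * cnj d) - (a * d + b * cnj c) * cnj (a * d + b * cnj c)
      = (a * cnj a - b * cnj b) * (c * cnj c - d * cnj d)"
    by (simp add: algebra_simps)
  then have "su11_mat (a * c + b * cnj d) (a * d + b * cnj c) \<in> carrier SU11"
    unfolding carrier_SU11_iff using * by (metis mult_1)
  with * show "A \<otimes>\<^bsub>SU11\<^esub> B \<in> carrier SU11" by (simp add: su11_mat_mult)
next
  fix A assume "A \<in> carrier SU11"
  then obtain a b where *: "A = su11_mat a b" "a * cnj a - b * cnj b = 1"
    by (auto simp: carrier_SU11_iff)
  have "su11_mat (cnj a) (- b) ** A = mat 1" "su11_mat (cnj a) (- b) \<in> carrier SU11"
  proof -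
    have "cnj a * a + (- b) * cnj b = 1" "cnj a * b + (- b) * cnj a = 0"
      using *(2) by (simp_all add: mult.commute)
    then show "su11_mat (cnj a) (- b) ** A = mat 1"
      by (simp only: *(1) su11_mat_mult su11_mat_one)
    have "cnj a * cnj (cnj a) - (- b) * cnj (- b) = 1"
      using *(2) by (simp add: mult.commute)
    then show "su11_mat (cnj a) (- b) \<in> carrier SU11"
      unfolding carrier_SU11_iff by blast
  qed
  then show "\<exists>B\<in>carrier SU11. B \<otimes>\<^bsub>SU11\<^esub> A = \<one>\<^bsub>SU11\<^esub>" by auto
next
  show "\<one>\<^bsub>SU11\<^esub> \<in> carrier SU11"
    unfolding carrier_SU11_iff SU11_simps su11_mat_one
    by (rule exI[of _ 1], rule exI[of _ 0]) simp
qed (simp_all add: matrix_mul_assoc)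

lemma SU11_centre_coset:
  "SU11_centre #>\<^bsub>SU11\<^esub> A = {A, - A}" "A <#\<^bsub>SU11\<^esub> SU11_centre = {A, - A}"
proof -
  have "(- mat 1) ** A = - A" "A ** (- mat 1) = - A"
    by (simp_all add: vec_eq_iff forall_2 matrix_matrix_mult_def sum_2 mat_def)
  then show "SU11_centre #>\<^bsub>SU11\<^esub> A = {A, - A}" "A <#\<^bsub>SU11\<^esub> SU11_centre = {A, - A}"
    by (auto simp: SU11_centre_def r_coset_def l_coset_def)
qed

lemma normal_SU11_centre: "SU11_centre \<lhd> SU11"
proof -
  have carrier: "mat 1 \<in> carrier SU11" "- mat 1 \<in> carrier SU11"
    unfolding carrier_SU11_iff su11_mat_one su11_mat_uminus
    by (rule exI[of _ 1], rule exI[of _ 0], simp) (rule exI[of _ "-1"], rule exI[of _ 0], simp)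
  have sq: "(- mat 1 :: complex^2^2) ** (- mat 1) = mat 1"
    by (simp add: su11_mat_one su11_mat_uminus su11_mat_mult)
  have inv: "inv\<^bsub>SU11\<^esub> (- mat 1) = - mat 1" "inv\<^bsub>SU11\<^esub> (mat 1) = mat 1"
    by (rule group.inv_equality [OF group_SU11]; simp add: carrier sq)+
  have neg: "(- mat 1) ** A = - A" "A ** (- mat 1) = - A" for A :: "complex^2^2"
    by (simp_all add: vec_eq_iff forall_2 matrix_matrix_mult_def sum_2 mat_def)
  have "subgroup SU11_centre SU11"
    by (rule group.subgroupI [OF group_SU11]) (auto simp: SU11_centre_def carrier inv neg)
  then show ?thesis
    by (simp add: normal_def normal_axioms_def group_SU11 SU11_centre_coset)
qed

lemma group_PSU11: "group PSU11"
  unfolding PSU11_def by (rule normal.factorgroup_is_group [OF normal_SU11_centre])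

lemma carrier_PSU11: "carrier PSU11 = (\<lambda>A. {A, - A}) ` carrier SU11"
  by (auto simp: PSU11_def FactGroup_def RCOSETS_def SU11_centre_coset)

lemma topspace_PSU11_topology: "topspace PSU11_topology = carrier PSU11"
  by (simp add: PSU11_topology_def carrier_PSU11 SU11_centre_coset)


section \<open>Discrete cocompact subgroups\<close>

definition discrete_subgroup_PSU11 :: "(complex^2^2) set set \<Rightarrow> bool" where
  "discrete_subgroup_PSU11 \<Gamma> \<longleftrightarrow>
     subgroup \<Gamma> PSU11 \<and> subtopology PSU11_topology \<Gamma> = discrete_topology \<Gamma>"

definition cocompact_PSU11 :: "(complex^2^2) set set \<Rightarrow> bool" where
  "cocompact_PSU11 \<Gamma> \<longleftrightarrow>
     compact_space (quotient_topology PSU11_topology (\<lambda>g. \<Gamma> #>\<^bsub>PSU11\<^esub> g))"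


section \<open>The action on the unit disk\<close>

definition su11_act :: "complex^2^2 \<Rightarrow> complex \<Rightarrow> complex" where
  "su11_act A z = (A $ 1 $ 1 * z + A $ 1 $ 2) / (cnj (A $ 1 $ 2) * z + cnj (A $ 1 $ 1))"

text \<open>An element of PSU(1,1) is a set of the form \<open>{A, - A}\<close>; both matrices act alike.\<close>

definition psu11_act :: "(complex^2^2) set \<Rightarrow> complex \<Rightarrow> complex" where
  "psu11_act \<gamma> z = (THE w. \<forall>A\<in>\<gamma>. w = su11_act A z)"

lemma psu11_act_eq: "psu11_act {A, - A} z = su11_act A z"
proof -
  have "su11_act (- A) z = - (A $ 1 $ 1 * z + A $ 1 $ 2) / - (cnj (A $ 1 $ 2) * z + cnj (A $ 1 $ 1))"
    by (simp add: su11_act_def)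
  also have "\<dots> = su11_act A z"
    unfolding su11_act_def by (subst minus_divide_left [symmetric], subst divide_minus_right) simp
  finally show ?thesis by (simp add: psu11_act_def)
qed

lemma psu11_act_in_disk:
  assumes "\<gamma> \<in> carrier PSU11" "z \<in> ball 0 1"
  shows "psu11_act \<gamma> z \<in> ball 0 1"
proof -
  obtain a b where g: "\<gamma> = {su11_mat a b, - su11_mat a b}" and ab: "a * cnj a - b * cnj b = 1"
    using assms(1) by (auto simp: carrier_PSU11 carrier_SU11_iff)
  have z: "(cmod z)\<^sup>2 < 1"
    using assms(2) by (simp add: abs_square_less_1)
  have "complex_of_real ((cmod (cnj b * z + cnj a))\<^sup>2 - (cmod (a * z + b))\<^sup>2)
      = (a * cnj a - b * cnj b) * (1 - z * cnj z)"
    unfolding of_real_diff complex_norm_square by (simp add: algebra_simps)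
  also have "\<dots> = complex_of_real (1 - (cmod z)\<^sup>2)"
    unfolding ab of_real_diff complex_norm_square by simp
  finally have "(cmod (cnj b * z + cnj a))\<^sup>2 - (cmod (a * z + b))\<^sup>2 = 1 - (cmod z)\<^sup>2"
    unfolding of_real_eq_iff .
  then have "(cmod (a * z + b))\<^sup>2 < (cmod (cnj b * z + cnj a))\<^sup>2" using z by simp
  then have less: "cmod (a * z + b) < cmod (cnj b * z + cnj a)"
    by (rule power2_less_imp_less) simp
  moreover have "0 < cmod (cnj b * z + cnj a)"
    using less by (rule le_less_trans [OF norm_ge_zero])
  ultimately show ?thesis
    by (simp add: g psu11_act_eq su11_act_def norm_divide)
qed

end

theory Submission
  imports Defs
begin

text \<open>
  Since \<open>\<Gamma>\<close> is discrete and matrices in SU(1,1) with bounded upper left entry form a compact set,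
  only finitely many \<open>\<gamma> \<in> \<Gamma>\<close> have an upper left entry of modulus at most a given bound.  As
  $1 - |\gamma z|^2 = (1 - |z|^2) / |\bar b z + \bar a|^2$, this makes the action properly
  discontinuous, and cocompactness yields $t < 1$ such that every orbit meets
  $\{|z|^2 < t\}$.  Take a smooth \<open>\<psi> \<ge> 0\<close> that is positive exactly on this disk.  Then
  $\Phi(z) = \sum_\gamma \psi(\gamma z)$ is locally finite, positive, smooth and \<open>\<Gamma>\<close>-invariant,
  and one puts $\varphi = \psi / \Phi$.
\<close>

section \<open>Functions of class $C^k$\<close>

text \<open>Since \<open>S\<close> is open, agreement on \<open>S\<close> is agreement near each of
  its points, so the unrestricted derivatives agree on \<open>S\<close> too. This allows a function
  to be replaced by a formula that is valid on \<open>S\<close> only.\<close>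

lemma cont_diff_on_cong:
  assumes "open S" "cont_diff_on k S f" "\<And>x. x \<in> S \<Longrightarrow> f x = g x"
  shows "cont_diff_on k S g"
  using assms(2,3)
proof (induction k arbitrary: f g)
  case 0
  then show ?case using continuous_on_cong [of S S f g] by simp
next
  case (Suc k)
  have der: "(g has_derivative frechet_derivative f (at x)) (at x)" if "x \<in> S" for x
  proof -
    have "(f has_derivative frechet_derivative f (at x)) (at x)"
      using that Suc.prems(1) frechet_derivative_works by auto
    then show ?thesis
      by (rule has_derivative_transform_within_open [OF _ assms(1) that Suc.prems(2)])
  qed
  show ?case
    unfolding cont_diff_on.simps
  proof (intro conjI ballI allI)
    show "g differentiable at x" if "x \<in> S" for x
      using der [OF that] by (auto simp: differentiable_def)
    show "cont_diff_on k S (\<lambda>x. frechet_derivative g (at x) v)" for v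
    proof (rule Suc.IH)
      show "cont_diff_on k S (\<lambda>x. frechet_derivative f (at x) v)"
        using Suc.prems(1) by simp
    qed (simp add: frechet_derivative_at [OF der])
  qed
qed

text \<open>Working form of the successor clause: a derivative found by the usual calculus rules
  takes the place of the chosen \<open>frechet_derivative\<close>, by uniqueness of
  derivatives.\<close>

lemma cont_diff_on_SucI:
  assumes "open S" "\<And>x. x \<in> S \<Longrightarrow> (f has_derivative f' x) (at x)"
    and "\<And>v. cont_diff_on k S (\<lambda>x. f' x v)"
  shows "cont_diff_on (Suc k) S f"
  unfolding cont_diff_on.simps
proof (intro conjI ballI allI)
  show "f differentiable at x" if "x \<in> S" for x
    using assms(2) that by (auto simp: differentiable_def)
  show "cont_diff_on k S (\<lambda>x. frechet_derivative f (at x) v)" for v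
    by (rule cont_diff_on_cong [OF assms(1) assms(3) [of v]])
      (simp add: frechet_derivative_at [OF assms(2)])
qed

lemma cont_diff_on_Suc_derivative:
  assumes "cont_diff_on (Suc k) S f" "x \<in> S"
  shows "(f has_derivative frechet_derivative f (at x)) (at x)"
  using assms frechet_derivative_works by auto

text \<open>The definition of $C^{k+1}$ constrains only the derivatives beyond differentiability of
  \<open>f\<close> itself, so monotonicity in \<open>k\<close> takes an induction, starting from
  differentiable implies continuous.\<close>

lemma cont_diff_on_SucD:
  "cont_diff_on (Suc k) S f \<Longrightarrow> cont_diff_on k S f"
proof (induction k arbitrary: f)
  case 0
  then show ?case
    by (auto intro!: continuous_at_imp_continuous_on differentiable_imp_continuous_within)
next
  case (Suc k)
  then show ?case by (metis cont_diff_on.simps(2))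
qed

text \<open>Every clause of the definition is pointwise, with derivatives that do not refer to
  \<open>S\<close>. It is meant for \<Phi>, which is a different finite sum on each smaller
  disk.\<close>

lemma cont_diff_on_local:
  assumes "\<And>x. x \<in> S \<Longrightarrow> \<exists>T. open T \<and> x \<in> T \<and> cont_diff_on k T f"
  shows "cont_diff_on k S f"
  using assms
proof (induction k arbitrary: f)
  case 0
  have "continuous (at x) f" if "x \<in> S" for x
    using 0 [OF that] by (auto simp: continuous_on_eq_continuous_at)
  then show ?case
    by (simp add: continuous_at_imp_continuous_on)
next
  case (Suc k)
  show ?case
    unfolding cont_diff_on.simps
  proof (intro conjI ballI allI)
    show "f differentiable at x" if "x \<in> S" for x
      using Suc.prems [OF that] by auto
    show "cont_diff_on k S (\<lambda>x. frechet_derivative f (at x) v)" for v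
      by (rule Suc.IH) (use Suc.prems in force)
  qed
qed

lemma cont_diff_on_subset: "cont_diff_on k S f \<Longrightarrow> T \<subseteq> S \<Longrightarrow> cont_diff_on k T f"
  by (induction k arbitrary: f) (auto intro: continuous_on_subset)

lemma cont_diff_on_const: "cont_diff_on k S (\<lambda>x. c)"
  by (induction k arbitrary: c) auto

lemma cont_diff_on_linear:
  assumes "bounded_linear f" "open S"
  shows "cont_diff_on k S f"
proof (cases k)
  case 0
  then show ?thesis using assms(1) by (simp add: linear_continuous_on)
next
  case (Suc l)
  show ?thesis unfolding Suc
    by (rule cont_diff_on_SucI [OF assms(2) bounded_linear_imp_has_derivative [OF assms(1)] cont_diff_on_const])
qed

lemma cont_diff_on_add:
  assumes "open S" "cont_diff_on k S f" "cont_diff_on k S g"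
  shows "cont_diff_on k S (\<lambda>x. f x + g x)"
  using assms(2,3)
proof (induction k arbitrary: f g)
  case 0
  then show ?case by (auto intro: continuous_intros)
next
  case (Suc k)
  show ?case
  proof (rule cont_diff_on_SucI [OF assms(1)])
    show "((\<lambda>x. f x + g x) has_derivative
        (\<lambda>v. frechet_derivative f (at x) v + frechet_derivative g (at x) v)) (at x)" if "x \<in> S" for x
      using that Suc.prems by (intro has_derivative_add cont_diff_on_Suc_derivative)
  qed (use Suc in auto)
qed

lemma cont_diff_on_sum:
  assumes "open S" "\<And>i. i \<in> I \<Longrightarrow> cont_diff_on k S (f i)"
  shows "cont_diff_on k S (\<lambda>x. \<Sum>i\<in>I. f i x)"
  using assms(2)
  by (induction I rule: infinite_finite_induct)
    (auto simp: cont_diff_on_const intro: cont_diff_on_add [OF assms(1)])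

lemma cont_diff_on_mult:
  fixes f g :: "'a::euclidean_space \<Rightarrow> 'b::real_normed_algebra"
  assumes "open S" "cont_diff_on k S f" "cont_diff_on k S g"
  shows "cont_diff_on k S (\<lambda>x. f x * g x)"
  using assms(2,3)
proof (induction k arbitrary: f g)
  case 0
  then show ?case by (auto intro: continuous_intros)
next
  case (Suc k)
  show ?case
  proof (rule cont_diff_on_SucI [OF assms(1)])
    show "((\<lambda>x. f x * g x) has_derivative
        (\<lambda>v. f x * frechet_derivative g (at x) v + frechet_derivative f (at x) v * g x)) (at x)"
      if "x \<in> S" for x
      using that Suc.prems by (intro has_derivative_mult cont_diff_on_Suc_derivative)
    show "cont_diff_on k S (\<lambda>x. f x * frechet_derivative g (at x) v + frechet_derivative f (at x) v * g x)"
      for v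
      using Suc.prems
      by (intro cont_diff_on_add [OF assms(1)] Suc.IH cont_diff_on_SucD [OF Suc.prems(1)]
          cont_diff_on_SucD [OF Suc.prems(2)]) auto
  qed
qed

text \<open>The derivative of $1/f$ is a product of $1/f$ and $f'$, so the induction hypothesis is
  applied to the same \<open>f\<close>.\<close>

lemma cont_diff_on_inverse:
  fixes f :: "'a::euclidean_space \<Rightarrow> 'b::real_normed_field"
  assumes "open S" "\<And>x. x \<in> S \<Longrightarrow> f x \<noteq> 0" "cont_diff_on k S f"
  shows "cont_diff_on k S (\<lambda>x. inverse (f x))"
  using assms(3)
proof (induction k)
  case 0
  then show ?case using assms(2) by (auto intro: continuous_intros)
next
  case (Suc k)
  have k: "cont_diff_on k S (\<lambda>x. inverse (f x))"
    by (rule Suc.IH) (rule cont_diff_on_SucD [OF Suc.prems])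
  show ?case
  proof (rule cont_diff_on_SucI [OF assms(1)])
    \<comment> \<open>The sign is written as a factor \<open>- 1\<close>, so that the product and
      constant rules cover the whole expression.\<close>
    show "((\<lambda>x. inverse (f x)) has_derivative
        (\<lambda>v. - 1 * (inverse (f x) * frechet_derivative f (at x) v * inverse (f x)))) (at x)"
      if "x \<in> S" for x
      using Deriv.has_derivative_inverse [OF assms(2) [OF that] cont_diff_on_Suc_derivative [OF Suc.prems that]]
      by simp
    show "cont_diff_on k S (\<lambda>x. - 1 * (inverse (f x) * frechet_derivative f (at x) v * inverse (f x)))"
      for v
      using Suc.prems k by (intro cont_diff_on_mult [OF assms(1)] cont_diff_on_const) auto
  qed
qed

text \<open>The outer function comes with the sequence \<open>h\<close> of its successive
  derivatives. The chain rule turns \<open>h n\<close> into \<open>h (Suc n)\<close>, hence the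
  induction over \<open>k\<close> for all \<open>n\<close> at once.\<close>

lemma cont_diff_on_compose_real:
  fixes g :: "'a::euclidean_space \<Rightarrow> real" and h :: "nat \<Rightarrow> real \<Rightarrow> real"
  assumes "open S" "\<And>n x. (h n has_real_derivative h (Suc n) x) (at x)" "cont_diff_on k S g"
  shows "cont_diff_on k S (\<lambda>x. h n (g x))"
  using assms(3)
proof (induction k arbitrary: n)
  case 0
  have "continuous_on UNIV (h n)"
    using assms(2) by (meson DERIV_isCont continuous_at_imp_continuous_on)
  then show ?case using 0 by (auto intro: continuous_on_compose2)
next
  case (Suc k)
  show ?case
  proof (rule cont_diff_on_SucI [OF assms(1)])
    show "((\<lambda>x. h n (g x)) has_derivative
        (\<lambda>v. frechet_derivative g (at x) v * h (Suc n) (g x))) (at x)" if "x \<in> S" for x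
      using DERIV_compose_FDERIV [OF assms(2) cont_diff_on_Suc_derivative [OF Suc.prems that]] .
    show "cont_diff_on k S (\<lambda>x. frechet_derivative g (at x) v * h (Suc n) (g x))" for v
      using Suc.prems cont_diff_on_SucD [OF Suc.prems]
      by (intro cont_diff_on_mult [OF assms(1)] Suc.IH) auto
  qed
qed

section \<open>Flat functions\<close>

text \<open>The polynomial factor makes the family closed under differentiation.\<close>

definition flat :: "real poly \<Rightarrow> real \<Rightarrow> real" where
  "flat p x = (if x > 0 then poly p (inverse x) * exp (- inverse x) else 0)"

lemma poly_times_exp_minus_tendsto_0:
  fixes p :: "real poly"
  shows "((\<lambda>x. poly p x * exp (- x)) \<longlongrightarrow> 0) at_top"
proof -
  have "((\<lambda>x. \<Sum>i\<le>degree p. coeff p i * (x ^ i / exp x)) \<longlongrightarrow> (\<Sum>i\<le>degree p. coeff p i * 0)) at_top"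
    by (intro tendsto_intros tendsto_power_div_exp_0)
  then show ?thesis
    by (simp add: poly_altdef exp_minus sum_divide_distrib field_simps)
qed

text \<open>With $u = 1/x$ we have $u' = -u^2$, so $p(u) e^{-u}$ has derivative $u^2 (p(u) - p'(u))
  e^{-u}$, again of the same shape. Only at 0 is a limit argument required.\<close>

lemma flat_has_derivative:
  "(flat p has_real_derivative flat ([:0, 0, 1:] * (p - pderiv p)) x) (at x)"
proof (cases x "0::real" rule: linorder_cases)
  case less
  have "\<forall>\<^sub>F y in nhds x. flat p y = 0"
    using eventually_nhds_in_open [of "{..<0}" x] less by (auto elim!: eventually_mono simp: flat_def)
  then have "(flat p has_real_derivative 0) (at x) \<longleftrightarrow> ((\<lambda>y. 0) has_real_derivative 0) (at x)"
    by (intro DERIV_cong_ev) auto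
  then show ?thesis using less by (simp add: flat_def)
next
  case greater
  have "((\<lambda>x. poly p (inverse x) * exp (- inverse x)) has_real_derivative
      flat ([:0, 0, 1:] * (p - pderiv p)) x) (at x)"
    using greater
    by (auto intro!: derivative_eq_intros simp: flat_def power2_eq_square algebra_simps)
  moreover have "\<forall>\<^sub>F y in nhds x. flat p y = poly p (inverse y) * exp (- inverse y)"
    using eventually_nhds_in_open [of "{0<..}" x] greater by (auto elim!: eventually_mono simp: flat_def)
  ultimately show ?thesis
    by (subst DERIV_cong_ev) auto
next
  case equal
  \<comment> \<open>The difference quotient at 0 is \<open>flat p y / y\<close>. Dividing by
    \<open>y\<close> multiplies by $u = 1/y$, which shifts the coefficients to
    \<open>pCons 0 p\<close>, and $u$ tends to infinity from the right.\<close>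
  have "((\<lambda>y. poly (pCons 0 p) (inverse y) * exp (- inverse y)) \<longlongrightarrow> 0) (at_right 0)"
    by (rule filterlim_compose [OF poly_times_exp_minus_tendsto_0 filterlim_inverse_at_top_right])
  then have "((\<lambda>y. flat p y / y) \<longlongrightarrow> 0) (at_right 0)"
    by (rule Lim_transform_eventually)
      (auto simp: flat_def eventually_at_right_field field_simps intro!: exI [of _ 1])
  moreover have "((\<lambda>y. flat p y / y) \<longlongrightarrow> 0) (at_left 0)"
    by (rule tendsto_eventually) (auto simp: flat_def eventually_at_left_field intro!: exI [of _ "-1"])
  ultimately have "((\<lambda>y. flat p y / y) \<longlongrightarrow> 0) (at 0)"
    by (rule filterlim_split_at [rotated])
  then show ?thesis
    by (simp add: equal has_field_derivative_iff flat_def)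
qed

lemma cont_diff_on_flat:
  fixes g :: "'a::euclidean_space \<Rightarrow> real"
  assumes "open S" "cont_diff_on k S g"
  shows "cont_diff_on k S (\<lambda>x. flat p (g x))"
proof -
  \<comment> \<open>\<open>flat (P n)\<close> is the \<open>n\<close>-th derivative of
    \<open>flat p\<close>.\<close>
  define P where "P n = ((\<lambda>p. [:0, 0, 1:] * (p - pderiv p)) ^^ n) p" for n
  have "(flat (P n) has_real_derivative flat (P (Suc n)) x) (at x)" for n x
    using flat_has_derivative [of "P n" x] by (simp add: P_def)
  then have "cont_diff_on k S (\<lambda>x. flat (P 0) (g x))"
    by (rule cont_diff_on_compose_real [OF assms(1) _ assms(2)])
  then show ?thesis by (simp add: P_def)
qed

section \<open>Discrete subgroups of PSU(1,1)\<close>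

lemma su11_cases:
  assumes "A \<in> carrier SU11"
  obtains a b where "A = su11_mat a b" "a * cnj a - b * cnj b = 1"
  using assms unfolding carrier_SU11_iff by blast

lemma su11_mat_in_carrier_iff: "su11_mat a b \<in> carrier SU11 \<longleftrightarrow> (cmod a)\<^sup>2 - (cmod b)\<^sup>2 = 1"
  unfolding carrier_SU11_iff su11_cond_iff
  by (metis su11_mat_nth(1,2))

lemma norm_less_SU11:
  assumes "su11_mat a b \<in> carrier SU11"
  shows "cmod b < cmod a"
proof (rule power2_less_imp_less)
  show "(cmod b)\<^sup>2 < (cmod a)\<^sup>2"
    using assms unfolding su11_mat_in_carrier_iff by linarith
qed simp

lemma mat_1_in_SU11: "mat 1 \<in> carrier SU11"
  using group.is_monoid [OF group_SU11] monoid.one_closed by fastforce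

lemma mult_in_SU11: "A \<in> carrier SU11 \<Longrightarrow> B \<in> carrier SU11 \<Longrightarrow> A ** B \<in> carrier SU11"
  using monoid.m_closed [OF group.is_monoid [OF group_SU11]] by fastforce

lemma inv_SU11:
  assumes "su11_mat a b \<in> carrier SU11"
  shows "inv\<^bsub>SU11\<^esub> (su11_mat a b) = su11_mat (cnj a) (- b)"
proof (rule group.inv_equality [OF group_SU11 _ assms])
  have "a * cnj a - b * cnj b = 1"
    using assms unfolding su11_mat_in_carrier_iff su11_cond_iff .
  then show "su11_mat (cnj a) (- b) \<otimes>\<^bsub>SU11\<^esub> su11_mat a b = \<one>\<^bsub>SU11\<^esub>"
    by (simp add: su11_mat_mult su11_mat_one mult.commute)
qed (use assms in \<open>simp add: su11_mat_in_carrier_iff\<close>)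

lemma uminus_in_SU11: "A \<in> carrier SU11 \<Longrightarrow> - A \<in> carrier SU11"
  by (metis minus_minus norm_minus_cancel su11_cases su11_cond_iff su11_mat_in_carrier_iff su11_mat_uminus)

lemma mult_PSU11:
  assumes "A \<in> carrier SU11" "B \<in> carrier SU11"
  shows "{A, - A} \<otimes>\<^bsub>PSU11\<^esub> {B, - B} = {A ** B, - (A ** B)}"
  using normal.rcos_sum [OF normal_SU11_centre assms]
  by (simp add: PSU11_def SU11_centre_coset)

lemma one_PSU11: "\<one>\<^bsub>PSU11\<^esub> = {mat 1, - mat 1}"
  by (simp add: PSU11_def SU11_centre_def)

lemma pair_eq_iff_SU11: "{A, - A} = {B, - B :: complex^2^2} \<longleftrightarrow> A = B \<or> A = - B"
  by (auto simp: doubleton_eq_iff)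

lemma pair_in_carrier_PSU11: "A \<in> carrier SU11 \<Longrightarrow> {A, - A} \<in> carrier PSU11"
  by (auto simp: carrier_PSU11)

text \<open>The elements of \<Gamma> are cosets \<open>{A, - A}\<close>, so
  \<open>\<Union>\<Gamma>\<close> is the full preimage of \<Gamma> in SU(1,1). Later arguments run
  on matrices in this preimage.\<close>

lemma Union_PSU11_iff:
  assumes "\<Gamma> \<subseteq> carrier PSU11"
  shows "A \<in> \<Union>\<Gamma> \<longleftrightarrow> A \<in> carrier SU11 \<and> {A, - A} \<in> \<Gamma>"
proof
  assume "A \<in> \<Union>\<Gamma>"
  then obtain B where B: "B \<in> carrier SU11" "{B, - B} \<in> \<Gamma>" "A = B \<or> A = - B"
    using assms unfolding carrier_PSU11 by blast
  then have "{A, - A} = {B, - B}" by auto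
  with B show "A \<in> carrier SU11 \<and> {A, - A} \<in> \<Gamma>"
    using uminus_in_SU11 by auto
qed auto

lemma subgroup_Union_PSU11:
  assumes "subgroup \<Gamma> PSU11"
  shows "subgroup (\<Union>\<Gamma>) SU11"
proof -
  note sub = subgroup.subset [OF assms]
  note iff = Union_PSU11_iff [OF sub]
  show ?thesis
  proof (rule group.subgroupI [OF group_SU11])
    show "\<Union>\<Gamma> \<subseteq> carrier SU11" using iff by blast
    show "\<Union>\<Gamma> \<noteq> {}"
      using subgroup.one_closed [OF assms] unfolding one_PSU11 by fast
    show "A \<otimes>\<^bsub>SU11\<^esub> B \<in> \<Union>\<Gamma>" if "A \<in> \<Union>\<Gamma>" "B \<in> \<Union>\<Gamma>" for A B
      using that subgroup.m_closed [OF assms, of "{A, - A}" "{B, - B}"]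
      unfolding iff by (simp add: mult_PSU11 mult_in_SU11)
    show "inv\<^bsub>SU11\<^esub> A \<in> \<Union>\<Gamma>" if "A \<in> \<Union>\<Gamma>" for A
    proof -
      let ?B = "inv\<^bsub>SU11\<^esub> A"
      have A: "A \<in> carrier SU11" "{A, - A} \<in> \<Gamma>" using that unfolding iff by auto
      have B: "?B \<in> carrier SU11" "?B ** A = mat 1"
        using group.inv_closed [OF group_SU11 A(1)] group.l_inv [OF group_SU11 A(1)] by auto
      have "inv\<^bsub>PSU11\<^esub> {A, - A} = {?B, - ?B}"
        by (rule group.inv_equality [OF group_PSU11])
          (simp_all add: mult_PSU11 A B one_PSU11 pair_in_carrier_PSU11)
      then show ?thesis
        unfolding iff using B(1) subgroup.m_inv_closed [OF assms A(2)] by simp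
    qed
  qed
qed

text \<open>The identity coset is open in \<Gamma>. Unfolding the subspace and quotient topologies
  turns this into a ball of matrices around \<open>mat 1\<close>. The sign remains because
  \<open>mat 1\<close> and \<open>- mat 1\<close> represent the same coset.\<close>

lemma discrete_subgroup_isolated:
  assumes "discrete_subgroup_PSU11 \<Gamma>"
  obtains e where "e > 0" "\<And>A. A \<in> \<Union>\<Gamma> \<Longrightarrow> dist A (mat 1) < e \<Longrightarrow> A = mat 1 \<or> A = - mat 1"
proof -
  have sub: "subgroup \<Gamma> PSU11" and top: "subtopology PSU11_topology \<Gamma> = discrete_topology \<Gamma>"
    using assms by (auto simp: discrete_subgroup_PSU11_def)
  note iff = Union_PSU11_iff [OF subgroup.subset [OF sub]]
  have one: "{mat 1, - mat 1} \<in> \<Gamma>"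
    using subgroup.one_closed [OF sub] unfolding one_PSU11 .
  then have "openin (subtopology PSU11_topology \<Gamma>) {{mat 1, - mat 1}}"
    by (simp add: top)
  then obtain U where U: "openin PSU11_topology U" "{{mat 1, - mat 1}} = U \<inter> \<Gamma>"
    by (auto simp: openin_subtopology)
  from U(1) have "openin (top_of_set (carrier SU11)) {A \<in> carrier SU11. {A, - A} \<in> U}"
    by (simp add: PSU11_topology_def openin_quotient_topology SU11_centre_coset)
  then obtain T where T: "open T" "{A \<in> carrier SU11. {A, - A} \<in> U} = carrier SU11 \<inter> T"
    by (auto simp: openin_open)
  have "mat 1 \<in> T"
    using T(2) U(2) mat_1_in_SU11 by blast
  then obtain e where e: "e > 0" "ball (mat 1) e \<subseteq> T"
    using T(1) openE by blast
  show thesis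
  proof (rule that [OF e(1)])
    fix A assume A: "A \<in> \<Union>\<Gamma>" "dist A (mat 1) < e"
    then have "A \<in> T" using e(2) by (auto simp: dist_commute)
    then have "{A, - A} \<in> U \<inter> \<Gamma>" using A T(2) iff by blast
    then have "{A, - A} = {mat 1, - mat 1}" unfolding U(2) [symmetric] by (rule singletonD)
    then show "A = mat 1 \<or> A = - mat 1" unfolding pair_eq_iff_SU11 .
  qed
qed

section \<open>Bounded parts of a discrete subgroup\<close>

lemma continuous_on_su11_mat [continuous_intros]:
  assumes "continuous_on S f" "continuous_on S g"
  shows "continuous_on S (\<lambda>x. su11_mat (f x) (g x))"
proof -
  have eq: "su11_mat a b =
      (\<chi> i j. if i = 1 then if j = 1 then a else b else if j = 1 then cnj b else cnj a)" for a b
    by (simp add: vec_eq_iff forall_2)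
  show ?thesis
    unfolding eq
  proof (intro continuous_on_vec_lambda)
    show "continuous_on S (\<lambda>x. if i = 1 then if j = 1 then f x else g x
        else if j = 1 then cnj (g x) else cnj (f x))" for i j :: 2
      using assms by (cases "i = 1"; cases "j = 1") (auto intro: continuous_intros)
  qed
qed

text \<open>The first row determines the matrix, so membership becomes equations between continuous
  functions of the entries.\<close>

lemma closed_carrier_SU11: "closed (carrier SU11)"
proof -
  have "carrier SU11 = {A. A = su11_mat (A $ 1 $ 1) (A $ 1 $ 2) \<and>
      A $ 1 $ 1 * cnj (A $ 1 $ 1) - A $ 1 $ 2 * cnj (A $ 1 $ 2) = 1}"
    unfolding set_eq_iff mem_Collect_eq carrier_SU11_iff by (metis su11_mat_nth(1,2))
  then show ?thesis
    by (simp only:) (intro closed_Collect_conj closed_Collect_eq continuous_intros)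
qed

text \<open>All four entries have modulus at most that of the upper left one, because $|b| < |a|$;
  the norm is at most the sum of these moduli.\<close>

lemma norm_SU11_le:
  assumes "A \<in> carrier SU11"
  shows "norm A \<le> 4 * cmod (A $ 1 $ 1)"
proof -
  obtain a b where A: "A = su11_mat a b"
    using assms su11_cases by blast
  then have ba: "cmod b < cmod a" using assms norm_less_SU11 by simp
  have "norm A \<le> norm (A $ 1) + norm (A $ 2)"
    using L2_set_le_sum [of UNIV "\<lambda>i. norm (A $ i)"] by (simp add: norm_vec_def sum_2)
  also have "\<dots> \<le> (cmod a + cmod b) + (cmod b + cmod a)"
    using L2_set_le_sum [of UNIV "\<lambda>i. norm (A $ 1 $ i)"] L2_set_le_sum [of UNIV "\<lambda>i. norm (A $ 2 $ i)"]
    by (intro add_mono) (simp_all add: norm_vec_def [where 'a = complex] sum_2 A)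
  finally show ?thesis using ba A by simp
qed

text \<open>An infinite set of this kind would accumulate at some \<open>L\<close> by compactness.
  Two elements \<open>A\<close> and \<open>B\<close> close to \<open>L\<close> have $A^{-1} B$ close
  to 1, so isolation of the identity forces \<open>B\<close> to be \<open>A\<close> or
  \<open>- A\<close>.\<close>

lemma finite_discrete_subgroup_bounded:
  assumes "discrete_subgroup_PSU11 \<Gamma>"
  shows "finite {A \<in> \<Union>\<Gamma>. cmod (A $ 1 $ 1) \<le> M}" (is "finite ?X")
proof (rule ccontr)
  assume inf: "infinite ?X"
  have sub: "subgroup (\<Union>\<Gamma>) SU11"
    using assms subgroup_Union_PSU11 by (auto simp: discrete_subgroup_PSU11_def)
  note SU = subgroup.mem_carrier [OF sub]
  obtain e where e: "e > 0" "\<And>A. A \<in> \<Union>\<Gamma> \<Longrightarrow> dist A (mat 1) < e \<Longrightarrow> A = mat 1 \<or> A = - mat 1"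
    using discrete_subgroup_isolated [OF assms] by blast
  let ?K = "{A \<in> carrier SU11. cmod (A $ 1 $ 1) \<le> M}"
  have "closed ?K"
    unfolding Collect_conj_eq Collect_mem_eq
    by (intro closed_Int closed_carrier_SU11 closed_Collect_le continuous_intros)
  moreover have "bounded ?K"
    unfolding bounded_iff by (rule exI [of _ "4 * M"]) (use norm_SU11_le in force)
  ultimately obtain L where L: "L \<in> ?K" "L islimpt ?X"
    using Heine_Borel_imp_Bolzano_Weierstrass [of ?K ?X] inf SU
    by (auto simp: compact_eq_bounded_closed)
  \<comment> \<open>This is $A^{-1} B$ on the group. The explicit entries make it continuous on all
    pairs of matrices, also where the group inverse has no meaning.\<close>
  define f :: "(complex^2^2) \<times> (complex^2^2) \<Rightarrow> complex^2^2" where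
    "f = (\<lambda>(A, B). su11_mat (cnj (A $ 1 $ 1)) (- (A $ 1 $ 2)) ** B)"
  have f: "f (A, B) = inv\<^bsub>SU11\<^esub> A ** B" if A: "A \<in> carrier SU11" for A B
  proof -
    obtain a b where "A = su11_mat a b" by (rule su11_cases [OF A])
    then show ?thesis using A by (simp add: f_def inv_SU11)
  qed
  have f_L: "f (L, L) = mat 1"
    using L(1) group.l_inv [OF group_SU11, of L] by (simp add: f)
  have "continuous_on UNIV f"
    unfolding f_def matrix_matrix_mult_def case_prod_unfold by (intro continuous_intros)
  then have "isCont f (L, L)"
    by (simp add: continuous_on_eq_continuous_at)
  then have "\<forall>\<^sub>F p in nhds (L, L). dist (f p) (mat 1) < e"
    using e(1) f_L by (metis continuous_at tendstoD tendsto_nhds_iff)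
  then obtain P Q where PQ: "eventually P (nhds L)" "eventually Q (nhds L)"
      "\<And>A B. P A \<Longrightarrow> Q B \<Longrightarrow> dist (f (A, B)) (mat 1) < e"
    unfolding nhds_prod eventually_prod_filter by blast
  from PQ(1,2) have "\<forall>\<^sub>F A in nhds L. P A \<and> Q A" by (rule eventually_conj)
  then obtain d where d: "d > 0" "\<And>A. dist A L < d \<Longrightarrow> P A \<and> Q A"
    unfolding eventually_nhds_metric by blast
  have inf': "infinite (?X \<inter> ball L d)"
    using L(2) d(1) by (simp add: islimpt_eq_infinite_ball)
  then have "?X \<inter> ball L d \<noteq> {}" by (rule infinite_imp_nonempty)
  then obtain A where A: "A \<in> ?X \<inter> ball L d" by (elim exE [OF ex_in_conv [THEN iffD2]])
  \<comment> \<open>Both signs are removed, since isolation determines \<open>B\<close> only up to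
    sign.\<close>
  have "infinite (?X \<inter> ball L d - {A, - A})"
    by (rule Diff_infinite_finite [OF _ inf']) simp
  then have "?X \<inter> ball L d - {A, - A} \<noteq> {}" by (rule infinite_imp_nonempty)
  then obtain B where B: "B \<in> ?X \<inter> ball L d - {A, - A}" by (elim exE [OF ex_in_conv [THEN iffD2]])
  have AB: "A \<in> carrier SU11" "B \<in> carrier SU11" using A B SU by auto
  let ?C = "inv\<^bsub>SU11\<^esub> A ** B"
  have "dist ?C (mat 1) < e"
    using PQ(3) [of A B] d(2) A B AB by (auto simp: f dist_commute)
  moreover have "?C \<in> \<Union>\<Gamma>"
    using subgroup.m_closed [OF sub subgroup.m_inv_closed [OF sub, of A], of B] A B by simp
  ultimately have "?C = mat 1 \<or> ?C = - mat 1" by (intro e(2))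
  moreover have "A ** ?C = B"
    using group.inv_solve_left' [OF group_SU11] AB group.r_inv [OF group_SU11 AB(1)]
    by (simp add: matrix_mul_assoc)
  moreover have "A ** (- mat 1) = - A"
    by (simp add: vec_eq_iff forall_2 matrix_matrix_mult_def sum_2 mat_def)
  ultimately have "B = A \<or> B = - A" by auto
  with B show False by blast
qed

text \<open>\<open>W n\<close> collects the matrices that some element of the subgroup moves to an
  upper left entry of modulus below \<open>n\<close>. These sets are open, invariant and increasing,
  and they exhaust the group, so finitely many of their images cover the compact quotient.\<close>

lemma cocompact_bounded_representatives:
  assumes "subgroup \<Gamma> PSU11" "cocompact_PSU11 \<Gamma>"
  obtains R where "\<And>A. A \<in> carrier SU11 \<Longrightarrow> \<exists>C\<in>\<Union>\<Gamma>. cmod ((C ** A) $ 1 $ 1) < R"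
proof -
  note subset = subgroup.subset [OF assms(1)]
  note iff = Union_PSU11_iff [OF subset]
  have sub: "subgroup (\<Union>\<Gamma>) SU11" by (rule subgroup_Union_PSU11 [OF assms(1)])
  define q where "q A = \<Gamma> #>\<^bsub>PSU11\<^esub> {A, - A}" for A
  define X where "X = quotient_topology PSU11_topology (\<lambda>g. \<Gamma> #>\<^bsub>PSU11\<^esub> g)"
  define W where "W n = {A \<in> carrier SU11. \<exists>C\<in>\<Union>\<Gamma>. cmod ((C ** A) $ 1 $ 1) < real n}" for n
  \<comment> \<open>The fibres of the composite projection \<open>q\<close> are orbits under left
    multiplication by \<open>\<Union>\<Gamma>\<close>.\<close>
  have q_eq: "\<exists>C\<in>\<Union>\<Gamma>. A = C ** B"
    if "A \<in> carrier SU11" "B \<in> carrier SU11" "q A = q B" for A B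
  proof -
    have "{A, - A} \<in> \<Gamma> #>\<^bsub>PSU11\<^esub> {B, - B}"
      using group.rcos_self [OF group_PSU11 pair_in_carrier_PSU11 [OF that(1)] assms(1)] that(3)
      by (simp add: q_def)
    then obtain h where h: "h \<in> \<Gamma>" "{A, - A} = h \<otimes>\<^bsub>PSU11\<^esub> {B, - B}"
      by (auto simp: r_coset_def)
    then obtain C where C: "C \<in> carrier SU11" "h = {C, - C}"
      using subset by (auto simp: carrier_PSU11)
    have "{A, - A} = {C ** B, - (C ** B)}"
      using h(2) C mult_PSU11 that(2) by metis
    \<comment> \<open>The sign moves into the left factor, as \<open>- C\<close> belongs to the
      coset \<open>h\<close> as well.\<close>
    then have "A = C ** B \<or> A = - C ** B"
      unfolding pair_eq_iff_SU11
      by (auto simp: vec_eq_iff forall_2 matrix_matrix_mult_def sum_2)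
    then show ?thesis using C(2) h(1) by blast
  qed
  have "quotient_map (top_of_set (carrier SU11)) PSU11_topology (\<lambda>A. {A, - A})"
    using quotient_map_quotient_topology [of "top_of_set (carrier SU11)" "\<lambda>A. SU11_centre #>\<^bsub>SU11\<^esub> A"]
    by (simp add: PSU11_topology_def SU11_centre_coset)
  then have "quotient_map (top_of_set (carrier SU11)) X ((\<lambda>g. \<Gamma> #>\<^bsub>PSU11\<^esub> g) \<circ> (\<lambda>A. {A, - A}))"
    unfolding X_def by (rule quotient_map_compose [OF _ quotient_map_quotient_topology])
  then have quot: "quotient_map (top_of_set (carrier SU11)) X q"
    by (simp add: q_def [abs_def] comp_def)
  have W_open: "openin (top_of_set (carrier SU11)) (W n)" for n
  proof -
    have "W n = carrier SU11 \<inter> (\<Union>C\<in>\<Union>\<Gamma>. {A. cmod ((C ** A) $ 1 $ 1) < real n})"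
      by (auto simp: W_def)
    moreover have "open {A. cmod ((C ** A) $ 1 $ 1) < real n}" for C :: "complex^2^2"
      unfolding matrix_matrix_mult_def by (intro open_Collect_less continuous_intros)
    ultimately show ?thesis
      by (simp only:) (intro openin_open_Int open_UN ballI)
  qed
  \<comment> \<open>Saturation makes \<open>W n\<close> the whole preimage of its image, which is
    what a quotient map requires for that image to be open.\<close>
  have W_saturated: "A \<in> W n" if AB: "A \<in> carrier SU11" "B \<in> W n" "q A = q B" for A B n
  proof -
    have B: "B \<in> carrier SU11" "\<exists>C\<in>\<Union>\<Gamma>. cmod ((C ** B) $ 1 $ 1) < real n"
      using AB(2) unfolding W_def by blast+
    obtain D where D: "D \<in> \<Union>\<Gamma>" "B = D ** A"
      using q_eq [OF B(1) AB(1) AB(3) [symmetric]] by blast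
    obtain C where C: "C \<in> \<Union>\<Gamma>" "cmod ((C ** B) $ 1 $ 1) < real n"
      using B(2) by blast
    have "C ** D \<in> \<Union>\<Gamma>"
      using subgroup.m_closed [OF sub C(1) D(1)] by simp
    moreover have "cmod ((C ** D ** A) $ 1 $ 1) < real n"
      using C(2) unfolding D(2) matrix_mul_assoc .
    ultimately show ?thesis
      using AB(1) unfolding W_def by blast
  qed
  have open_V: "openin X (q ` W n)" for n
  proof -
    have "{A \<in> carrier SU11. q A \<in> q ` W n} = W n"
    proof
      show "{A \<in> carrier SU11. q A \<in> q ` W n} \<subseteq> W n"
        using W_saturated by blast
      show "W n \<subseteq> {A \<in> carrier SU11. q A \<in> q ` W n}"
        unfolding W_def by blast
    qed
    moreover have "q ` W n \<subseteq> topspace X"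
      using quot by (auto simp: quotient_map_def W_def)
    then have "openin (top_of_set (carrier SU11)) {A \<in> carrier SU11. q A \<in> q ` W n} \<longleftrightarrow>
        openin X (q ` W n)"
      using quot unfolding quotient_map_def topspace_euclidean_subtopology by blast
    ultimately show ?thesis
      using W_open [of n] by (simp only:)
  qed
  have cover: "topspace X \<subseteq> \<Union>(range (\<lambda>n. q ` W n))"
  proof -
    \<comment> \<open>The translate by \<open>mat 1\<close> already suffices; adding 1 to the
      ceiling makes the bound strict.\<close>
    have "A \<in> W (nat \<lceil>cmod (A $ 1 $ 1)\<rceil> + 1)" if "A \<in> carrier SU11" for A
    proof -
      have "mat 1 \<in> \<Union>\<Gamma>" using subgroup.one_closed [OF sub] by simp
      moreover have "cmod ((mat 1 ** A) $ 1 $ 1) < real (nat \<lceil>cmod (A $ 1 $ 1)\<rceil> + 1)"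
        by simp linarith
      ultimately show ?thesis using that unfolding W_def by blast
    qed
    moreover have "topspace X = q ` carrier SU11"
      using quot by (simp add: quotient_map_def)
    ultimately show ?thesis by auto
  qed
  have compact: "compactin X (topspace X)"
    using assms(2) by (simp add: X_def cocompact_PSU11_def compact_space_def)
  have "\<exists>F. finite F \<and> F \<subseteq> range (\<lambda>n. q ` W n) \<and> topspace X \<subseteq> \<Union>F"
    by (rule compactinD [OF compact _ cover]) (use open_V in \<open>elim rangeE, simp\<close>)
  then obtain F where F: "finite F" "F \<subseteq> range (\<lambda>n. q ` W n)" "topspace X \<subseteq> \<Union>F"
    by (elim exE conjE)
  from finite_subset_image [OF F(1,2)]
  obtain I where I: "finite I" "F = (\<lambda>n. q ` W n) ` I"
    by (elim exE conjE)
  have "\<exists>C\<in>\<Union>\<Gamma>. cmod ((C ** A) $ 1 $ 1) < real (Max I)" if A: "A \<in> carrier SU11" for A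
  proof -
    have "q A \<in> topspace X" using quot A by (auto simp: quotient_map_def)
    then obtain n where n: "n \<in> I" "q A \<in> q ` W n" using F(3) I(2) by blast
    then obtain B where "B \<in> W n" "q A = q B" by blast
    then have "A \<in> W n" by (rule W_saturated [OF A])
    then obtain C where "C \<in> \<Union>\<Gamma>" "cmod ((C ** A) $ 1 $ 1) < real n"
      unfolding W_def by blast
    moreover have "real n \<le> real (Max I)" using I(1) n(1) by simp
    ultimately show ?thesis using less_le_trans by blast
  qed
  then show thesis by (rule that)
qed

section \<open>The action on the disk\<close>

lemma su11_act_mat: "su11_act (su11_mat a b) z = (a * z + b) / (cnj b * z + cnj a)"
  by (simp add: su11_act_def)

lemma su11_denominator_nonzero:
  assumes "su11_mat a b \<in> carrier SU11" "z \<in> ball 0 1"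
  shows "cnj b * z + cnj a \<noteq> 0"
proof
  assume "cnj b * z + cnj a = 0"
  then have "cmod a = cmod b * cmod z"
    by (metis add.inverse_unique add.commute complex_mod_cnj norm_minus_cancel norm_mult)
  moreover have "cmod b * cmod z \<le> cmod b * 1"
    using assms(2) by (intro mult_left_mono) auto
  ultimately show False using norm_less_SU11 [OF assms(1)] by simp
qed

lemma one_minus_norm_su11_act:
  assumes "su11_mat a b \<in> carrier SU11" "z \<in> ball 0 1"
  shows "1 - (cmod (su11_act (su11_mat a b) z))\<^sup>2 = (1 - (cmod z)\<^sup>2) / (cmod (cnj b * z + cnj a))\<^sup>2"
proof -
  have ab: "a * cnj a - b * cnj b = 1"
    using assms(1) unfolding su11_mat_in_carrier_iff su11_cond_iff .
  have "complex_of_real ((cmod (cnj b * z + cnj a))\<^sup>2 - (cmod (a * z + b))\<^sup>2)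
      = (a * cnj a - b * cnj b) * (1 - z * cnj z)"
    unfolding of_real_diff complex_norm_square by (simp add: algebra_simps)
  also have "\<dots> = complex_of_real (1 - (cmod z)\<^sup>2)"
    unfolding ab of_real_diff complex_norm_square by simp
  finally have "(cmod (cnj b * z + cnj a))\<^sup>2 - (cmod (a * z + b))\<^sup>2 = 1 - (cmod z)\<^sup>2"
    unfolding of_real_eq_iff .
  then show ?thesis
    using su11_denominator_nonzero [OF assms]
    by (simp add: su11_act_mat norm_divide power_divide field_simps)
qed

lemma su11_act_mult:
  assumes "A \<in> carrier SU11" "B \<in> carrier SU11" "z \<in> ball 0 1"
  shows "su11_act (A ** B) z = su11_act A (su11_act B z)"
proof -
  obtain a b where A: "A = su11_mat a b" using assms(1) su11_cases by blast
  obtain c d where B: "B = su11_mat c d" using assms(2) su11_cases by blast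
  have "cnj d * z + cnj c \<noteq> 0"
    using su11_denominator_nonzero assms B by blast
  then show ?thesis
    unfolding A B su11_mat_mult su11_act_mat
    by (simp add: divide_simps) (simp add: algebra_simps)
qed

lemma psu11_act_mult:
  assumes "g \<in> carrier PSU11" "h \<in> carrier PSU11" "z \<in> ball 0 1"
  shows "psu11_act (g \<otimes>\<^bsub>PSU11\<^esub> h) z = psu11_act g (psu11_act h z)"
  using assms by (auto simp: carrier_PSU11 mult_PSU11 psu11_act_eq su11_act_mult)

lemma psu11_act_one: "psu11_act \<one>\<^bsub>PSU11\<^esub> z = z"
  by (simp add: one_PSU11 psu11_act_eq su11_act_def mat_def)

text \<open>Write \<open>z\<close> as the image of 0 under a matrix \<open>A\<close>. If
  \<open>C ** A\<close> has upper left entry $a$, then the translate of \<open>z\<close> by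
  \<open>C\<close> satisfies $1 - |Cz|^2 = 1/|a|^2$, and a suitable \<open>C\<close> keeps $|a|$
  below \<open>R\<close>.\<close>

lemma cocompact_orbit_meets_disk:
  assumes "subgroup \<Gamma> PSU11" "cocompact_PSU11 \<Gamma>"
  obtains t where "t < 1" "\<And>z. z \<in> ball 0 1 \<Longrightarrow> \<exists>\<gamma>\<in>\<Gamma>. (cmod (psu11_act \<gamma> z))\<^sup>2 < t"
proof -
  obtain R where R: "\<And>A. A \<in> carrier SU11 \<Longrightarrow> \<exists>C\<in>\<Union>\<Gamma>. cmod ((C ** A) $ 1 $ 1) < R"
    using cocompact_bounded_representatives [OF assms] by blast
  note iff = Union_PSU11_iff [OF subgroup.subset [OF assms(1)]]
  have orbit: "\<exists>\<gamma>\<in>\<Gamma>. (cmod (psu11_act \<gamma> z))\<^sup>2 < 1 - 1 / R\<^sup>2" if z: "z \<in> ball 0 1" for z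
  proof -
    define s where "s = sqrt (1 - (cmod z)\<^sup>2)"
    have z2: "(cmod z)\<^sup>2 < 1" using z by (simp add: abs_square_less_1)
    then have s: "s > 0" "s\<^sup>2 = 1 - (cmod z)\<^sup>2" by (simp_all add: s_def)
    \<comment> \<open>This matrix sends 0 to \<open>z\<close>, and dividing by \<open>s\<close>
      normalises the determinant to 1.\<close>
    define A where "A = su11_mat (1 / s) (z / s)"
    have A: "A \<in> carrier SU11"
      using s z2 by (simp add: A_def su11_mat_in_carrier_iff norm_divide power_divide
          diff_divide_distrib [symmetric])
    obtain C where C: "C \<in> \<Union>\<Gamma>" "cmod ((C ** A) $ 1 $ 1) < R" using R [OF A] by blast
    have CU: "C \<in> carrier SU11" "{C, - C} \<in> \<Gamma>" using C(1) unfolding iff by auto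
    obtain a b where ab: "C ** A = su11_mat a b" using mult_in_SU11 [OF CU(1) A] su11_cases by blast
    have in_SU: "su11_mat a b \<in> carrier SU11" using mult_in_SU11 [OF CU(1) A] ab by simp
    have "su11_act A 0 = z" using s(1) by (simp add: A_def su11_act_mat)
    then have "psu11_act {C, - C} z = su11_act (su11_mat a b) 0"
      using su11_act_mult [OF CU(1) A, of 0] by (simp add: psu11_act_eq ab)
    then have norm_eq: "1 - (cmod (psu11_act {C, - C} z))\<^sup>2 = 1 / (cmod a)\<^sup>2"
      using one_minus_norm_su11_act [OF in_SU, of 0] by simp
    have R_gt: "cmod a < R" using C(2) by (simp add: ab)
    have a_pos: "cmod a > 0"
      using le_less_trans [OF norm_ge_zero norm_less_SU11 [OF in_SU]] .
    from less_trans [OF a_pos R_gt] have "1 / R\<^sup>2 < 1 / (cmod a)\<^sup>2"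
      by (intro divide_strict_left_mono power_strict_mono mult_pos_pos zero_less_power R_gt a_pos) auto
    with norm_eq show ?thesis
      by (intro bexI [OF _ CU(2)]) linarith
  qed
  \<comment> \<open>As \<open>1 / 0 = 0\<close>, the value \<open>R = 0\<close> would make the bound
    equal to 1, which is not strict enough.\<close>
  have "R \<noteq> 0"
    using R [OF mat_1_in_SU11] by (metis norm_ge_zero not_less)
  then have "1 - 1 / R\<^sup>2 < 1" by simp
  then show thesis using orbit by (rule that)
qed

lemma finite_discrete_subgroup_return:
  assumes "discrete_subgroup_PSU11 \<Gamma>" "r < 1" "t < 1"
  shows "finite {\<gamma> \<in> \<Gamma>. \<exists>z\<in>ball 0 r. (cmod (psu11_act \<gamma> z))\<^sup>2 < t}"
proof (rule finite_subset)
  let ?M = "1 / (sqrt (1 - t) * (1 - r))"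
  have sub: "\<Gamma> \<subseteq> carrier PSU11"
    using assms(1) subgroup.subset by (auto simp: discrete_subgroup_PSU11_def)
  show "finite ((\<lambda>A. {A, - A}) ` {A \<in> \<Union>\<Gamma>. cmod (A $ 1 $ 1) \<le> ?M})"
    by (intro finite_imageI finite_discrete_subgroup_bounded assms(1))
  show "{\<gamma> \<in> \<Gamma>. \<exists>z\<in>ball 0 r. (cmod (psu11_act \<gamma> z))\<^sup>2 < t} \<subseteq>
      (\<lambda>A. {A, - A}) ` {A \<in> \<Union>\<Gamma>. cmod (A $ 1 $ 1) \<le> ?M}"
  proof clarify
    fix \<gamma> z assume \<gamma>: "\<gamma> \<in> \<Gamma>" and z: "z \<in> ball 0 r" "(cmod (psu11_act \<gamma> z))\<^sup>2 < t"
    obtain A where "A \<in> carrier SU11" "\<gamma> = {A, - A}"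
      using \<gamma> sub by (auto simp: carrier_PSU11)
    then obtain a b where A: "\<gamma> = {su11_mat a b, - su11_mat a b}" "su11_mat a b \<in> carrier SU11"
      using su11_cases by metis
    have z1: "z \<in> ball 0 1" using z(1) assms(2) by auto
    let ?w = "cmod (cnj b * z + cnj a)"
    have w: "?w > 0" using su11_denominator_nonzero [OF A(2) z1] by simp
    have "1 - t < (1 - (cmod z)\<^sup>2) / ?w\<^sup>2"
      using z(2) one_minus_norm_su11_act [OF A(2) z1] by (simp add: A(1) psu11_act_eq)
    then have "(1 - t) * ?w\<^sup>2 < 1 - (cmod z)\<^sup>2"
      using w by (simp add: pos_less_divide_eq)
    also have "\<dots> \<le> 1" by simp
    finally have "(sqrt (1 - t) * ?w)\<^sup>2 < 1\<^sup>2"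
      using assms(3) by (simp add: power_mult_distrib)
    then have "sqrt (1 - t) * ?w < 1" by (rule power_less_imp_less_base) simp
    moreover have "cmod a * (1 - r) \<le> ?w"
    proof -
      have "cmod b \<le> cmod a"
        using norm_less_SU11 [OF A(2)] by simp
      then have "cmod b * cmod z \<le> cmod a * r"
        using z(1) by (intro mult_mono) auto
      moreover have "cmod a - cmod b * cmod z \<le> ?w"
        using norm_diff_ineq [of "cnj a" "cnj b * z"] by (simp add: norm_mult add.commute)
      ultimately show ?thesis by (simp add: right_diff_distrib)
    qed
    then have "sqrt (1 - t) * (cmod a * (1 - r)) \<le> sqrt (1 - t) * ?w"
      using assms(3) by (intro mult_left_mono) auto
    ultimately have "cmod a * (sqrt (1 - t) * (1 - r)) \<le> 1"
      by (simp add: mult_ac)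
    moreover have "sqrt (1 - t) * (1 - r) > 0"
      using assms(2,3) by simp
    ultimately have "cmod a \<le> ?M"
      by (simp only: pos_le_divide_eq)
    then show "\<gamma> \<in> (\<lambda>A. {A, - A}) ` {A \<in> \<Union>\<Gamma>. cmod (A $ 1 $ 1) \<le> ?M}"
      using \<gamma> A(1) by (intro image_eqI [of _ _ "su11_mat a b"]) auto
  qed
qed

section \<open>Smoothness of the cutoff along the action\<close>

lemma cont_diff_on_norm_affine_power2:
  fixes c d :: complex
  assumes "open S"
  shows "cont_diff_on k S (\<lambda>z. (cmod (c * z + d))\<^sup>2)"
proof -
  have "bounded_linear (\<lambda>z. Re (c * z))" "bounded_linear (\<lambda>z. Im (c * z))"
    by (intro bounded_linear_compose [OF bounded_linear_Re] bounded_linear_compose [OF bounded_linear_Im]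
        bounded_linear_mult_right)+
  then have "cont_diff_on k S (\<lambda>z. (Re (c * z) + Re d) * (Re (c * z) + Re d) +
      (Im (c * z) + Im d) * (Im (c * z) + Im d))"
    by (intro cont_diff_on_add cont_diff_on_mult cont_diff_on_linear cont_diff_on_const assms)
  moreover have "(cmod w)\<^sup>2 = Re w * Re w + Im w * Im w" for w
    unfolding cmod_power2 by (simp add: power2_eq_square)
  ultimately show ?thesis
    by (simp only: plus_complex.sel)
qed

lemma cont_diff_on_flat_norm_psu11_act:
  assumes "\<gamma> \<in> carrier PSU11"
  shows "cont_diff_on k (ball 0 1) (\<lambda>z. flat p (t - (cmod (psu11_act \<gamma> z))\<^sup>2))"
proof -
  obtain A where "A \<in> carrier SU11" "\<gamma> = {A, - A}"
    using assms by (auto simp: carrier_PSU11)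
  then obtain a b where A: "\<gamma> = {su11_mat a b, - su11_mat a b}" "su11_mat a b \<in> carrier SU11"
    using su11_cases by metis
  have eq: "t - 1 + (1 + - 1 * (cmod (1 * z + 0))\<^sup>2) * inverse ((cmod (cnj b * z + cnj a))\<^sup>2)
      = t - (cmod (psu11_act \<gamma> z))\<^sup>2" if "z \<in> ball 0 1" for z
    using one_minus_norm_su11_act [OF A(2) that] by (simp add: A(1) psu11_act_eq divide_inverse)
  have "cont_diff_on k (ball 0 1) (\<lambda>z. t - 1 + (1 + - 1 * (cmod (1 * z + 0))\<^sup>2) *
      inverse ((cmod (cnj b * z + cnj a))\<^sup>2))"
    using su11_denominator_nonzero [OF A(2)]
    by (intro cont_diff_on_add cont_diff_on_mult cont_diff_on_inverse cont_diff_on_const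
        cont_diff_on_norm_affine_power2 open_ball) auto
  then have "cont_diff_on k (ball 0 1) (\<lambda>z. t - (cmod (psu11_act \<gamma> z))\<^sup>2)"
    by (rule cont_diff_on_cong [OF open_ball _ eq])
  then show ?thesis
    by (rule cont_diff_on_flat [OF open_ball])
qed

section \<open>The partition of unity\<close>

theorem lemma1:
  fixes \<Gamma> :: "(complex^2^2) set set"
  assumes "discrete_subgroup_PSU11 \<Gamma>"
    and "cocompact_PSU11 \<Gamma>"
  shows "\<exists>\<phi> :: complex \<Rightarrow> real.
           smooth_on (ball 0 1) \<phi> \<and>
           (\<forall>z\<in>ball 0 1. 0 \<le> \<phi> z \<and> \<phi> z \<le> 1) \<and>
           (\<forall>z\<in>ball 0 1. \<exists>U S. open U \<and> z \<in> U \<and> U \<subseteq> ball 0 1 \<and> finite S \<and> S \<subseteq> \<Gamma> \<and>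
              (\<forall>\<gamma>\<in>\<Gamma> - S. \<forall>w\<in>psu11_act \<gamma> ` U. \<phi> w = 0)) \<and>
           (\<forall>z\<in>ball 0 1. ((\<lambda>\<gamma>. \<phi> (psu11_act \<gamma> z)) has_sum 1) \<Gamma>)"
proof -
  have sub: "subgroup \<Gamma> PSU11" using assms(1) by (simp add: discrete_subgroup_PSU11_def)
  note carrier = subgroup.mem_carrier [OF sub]
  obtain t where t: "t < 1" "\<And>z. z \<in> ball 0 1 \<Longrightarrow> \<exists>\<gamma>\<in>\<Gamma>. (cmod (psu11_act \<gamma> z))\<^sup>2 < t"
    using cocompact_orbit_meets_disk [OF sub assms(2)] by blast
  \<comment> \<open>With the constant polynomial 1, \<open>flat\<close> is $e^{-1/x}$ for $x > 0$
    and 0 otherwise.\<close>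
  define \<psi> :: "complex \<Rightarrow> real" where "\<psi> z = flat 1 (t - (cmod z)\<^sup>2)" for z
  have \<psi>_nonneg: "\<psi> z \<ge> 0" and \<psi>_pos: "\<psi> z > 0 \<longleftrightarrow> (cmod z)\<^sup>2 < t"
    and \<psi>_zero: "\<psi> z = 0 \<longleftrightarrow> \<not> (cmod z)\<^sup>2 < t" for z
    by (auto simp: \<psi>_def flat_def)
  define \<Phi> where "\<Phi> z = (\<Sum>\<^sub>\<infinity>\<gamma>\<in>\<Gamma>. \<psi> (psu11_act \<gamma> z))" for z
  \<comment> \<open>The group elements whose summand is nonzero somewhere on
    \<open>ball 0 r\<close>. One finite set thus serves the whole disk of radius
    \<open>r < 1\<close>.\<close>
  define F where "F r = {\<gamma> \<in> \<Gamma>. \<exists>z\<in>ball 0 r. (cmod (psu11_act \<gamma> z))\<^sup>2 < t}" for r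
  have F: "finite (F r)" if "r < 1" for r
    unfolding F_def by (rule finite_discrete_subgroup_return [OF assms(1) that t(1)])
  have \<psi>_F: "\<psi> (psu11_act \<gamma> z) = 0" if "\<gamma> \<in> \<Gamma> - F r" "z \<in> ball 0 r" for \<gamma> z r
    using that by (auto simp: F_def \<psi>_zero)
  have radius: "\<exists>r<1. z \<in> ball 0 r" if "z \<in> ball 0 1" for z :: complex
    using that dense by auto
  have sum: "((\<lambda>\<gamma>. \<psi> (psu11_act \<gamma> z)) has_sum (\<Sum>\<gamma>\<in>F r. \<psi> (psu11_act \<gamma> z))) \<Gamma>"
    if "r < 1" "z \<in> ball 0 r" for z r
    by (rule has_sum_finite_neutralI [OF F [OF that(1)]])
      (use that \<psi>_F in \<open>auto simp: F_def\<close>)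
  then have \<Phi>_eq: "\<Phi> z = (\<Sum>\<gamma>\<in>F r. \<psi> (psu11_act \<gamma> z))" if "r < 1" "z \<in> ball 0 r" for z r
    unfolding \<Phi>_def using that infsumI by blast
  have \<Phi>_sum: "((\<lambda>\<gamma>. \<psi> (psu11_act \<gamma> z)) has_sum \<Phi> z) \<Gamma>" if "z \<in> ball 0 1" for z
    using sum \<Phi>_eq radius [OF that] by metis
  \<comment> \<open>All summands are nonnegative, so a single one is at most the total.\<close>
  have \<Phi>_ge: "\<psi> (psu11_act \<gamma> z) \<le> \<Phi> z" if "z \<in> ball 0 1" "\<gamma> \<in> \<Gamma>" for z \<gamma>
    using has_sum_mono2 [OF has_sum_finite [of "{\<gamma>}" "\<lambda>\<gamma>. \<psi> (psu11_act \<gamma> z)"] \<Phi>_sum [OF that(1)]]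
      that(2) \<psi>_nonneg by simp
  have \<Phi>_pos: "\<Phi> z > 0" if "z \<in> ball 0 1" for z
    using t(2) [OF that] \<Phi>_ge [OF that] \<psi>_pos by (meson less_le_trans)
  have \<Phi>_invariant: "\<Phi> (psu11_act \<delta> z) = \<Phi> z" if z: "z \<in> ball 0 1" and \<delta>: "\<delta> \<in> \<Gamma>" for z \<delta>
  proof -
    \<comment> \<open>Replacing \<open>z\<close> by its translate under \<delta> multiplies the
      summation index by \<delta> on the right, which permutes \<Gamma>.\<close>
    have "bij_betw (\<lambda>\<gamma>. \<gamma> \<otimes>\<^bsub>PSU11\<^esub> \<delta>) \<Gamma> \<Gamma>"
    proof (rule bij_betwI [where g = "\<lambda>\<gamma>. \<gamma> \<otimes>\<^bsub>PSU11\<^esub> inv\<^bsub>PSU11\<^esub> \<delta>"])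
      interpret PSU11: group PSU11 by (rule group_PSU11)
      show "\<gamma> \<otimes>\<^bsub>PSU11\<^esub> \<delta> \<otimes>\<^bsub>PSU11\<^esub> inv\<^bsub>PSU11\<^esub> \<delta> = \<gamma>"
        "\<gamma> \<otimes>\<^bsub>PSU11\<^esub> inv\<^bsub>PSU11\<^esub> \<delta> \<otimes>\<^bsub>PSU11\<^esub> \<delta> = \<gamma>" if "\<gamma> \<in> \<Gamma>" for \<gamma>
        using that \<delta> carrier by (simp_all add: PSU11.m_assoc)
    qed (use \<delta> subgroup.m_closed [OF sub] subgroup.m_inv_closed [OF sub] in auto)
    from infsum_reindex_bij_betw [OF this, of "\<lambda>\<gamma>. \<psi> (psu11_act \<gamma> z)"]
    have "(\<Sum>\<^sub>\<infinity>\<gamma>\<in>\<Gamma>. \<psi> (psu11_act (\<gamma> \<otimes>\<^bsub>PSU11\<^esub> \<delta>) z)) = \<Phi> z"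
      by (simp add: \<Phi>_def)
    moreover have "(\<Sum>\<^sub>\<infinity>\<gamma>\<in>\<Gamma>. \<psi> (psu11_act (\<gamma> \<otimes>\<^bsub>PSU11\<^esub> \<delta>) z)) = \<Phi> (psu11_act \<delta> z)"
      unfolding \<Phi>_def by (rule infsum_cong) (metis psu11_act_mult carrier \<delta> z)
    ultimately show ?thesis by simp
  qed
  define \<phi> where "\<phi> z = \<psi> z * inverse (\<Phi> z)" for z
  have act_ball: "psu11_act \<gamma> z \<in> ball 0 1" if "\<gamma> \<in> \<Gamma>" "z \<in> ball 0 1" for \<gamma> z
    using psu11_act_in_disk carrier that by blast
  have smooth_\<psi>: "cont_diff_on k (ball 0 1) (\<lambda>z. \<psi> (psu11_act \<gamma> z))" if "\<gamma> \<in> \<Gamma>" for k \<gamma>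
    unfolding \<psi>_def by (rule cont_diff_on_flat_norm_psu11_act [OF carrier [OF that]])
  have one: "\<one>\<^bsub>PSU11\<^esub> \<in> \<Gamma>" by (rule subgroup.one_closed [OF sub])
  have "smooth_on (ball 0 1) \<phi>"
    unfolding smooth_on_def
  proof
    fix k
    have "cont_diff_on k (ball 0 1) \<Phi>"
    proof (rule cont_diff_on_local)
      fix z :: complex assume "z \<in> ball 0 1"
      then obtain r where r: "r < 1" "z \<in> ball 0 r" using radius by blast
      have "cont_diff_on k (ball 0 r) (\<lambda>w. \<psi> (psu11_act \<gamma> w))" if "\<gamma> \<in> F r" for \<gamma>
        by (rule cont_diff_on_subset [OF smooth_\<psi>]) (use that r(1) in \<open>auto simp: F_def\<close>)
      then have "cont_diff_on k (ball 0 r) (\<lambda>w. \<Sum>\<gamma>\<in>F r. \<psi> (psu11_act \<gamma> w))"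
        by (intro cont_diff_on_sum) auto
      then have "cont_diff_on k (ball 0 r) \<Phi>"
        by (rule cont_diff_on_cong [OF open_ball]) (simp only: \<Phi>_eq [OF r(1)])
      then show "\<exists>T. open T \<and> z \<in> T \<and> cont_diff_on k T \<Phi>"
        using r(2) by blast
    qed
    \<comment> \<open>The numerator \<psi> is itself the summand of \<Phi> belonging to the
      identity. The same observation gives the upper bound 1 below.\<close>
    then show "cont_diff_on k (ball 0 1) \<phi>"
      unfolding \<phi>_def [abs_def] using smooth_\<psi> [OF one, of k] \<Phi>_pos
      by (intro cont_diff_on_mult cont_diff_on_inverse) (auto simp: psu11_act_one less_le)
  qed
  moreover have "0 \<le> \<phi> z \<and> \<phi> z \<le> 1" if "z \<in> ball 0 1" for z
    using \<psi>_nonneg [of z] \<Phi>_pos [OF that] \<Phi>_ge [OF that one]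
    by (simp add: \<phi>_def psu11_act_one field_simps)
  moreover have "\<exists>U S. open U \<and> z \<in> U \<and> U \<subseteq> ball 0 1 \<and> finite S \<and> S \<subseteq> \<Gamma> \<and>
      (\<forall>\<gamma>\<in>\<Gamma> - S. \<forall>w\<in>psu11_act \<gamma> ` U. \<phi> w = 0)" if z: "z \<in> ball 0 1" for z
  proof -
    \<comment> \<open>The neighborhood is a whole disk centred at 0 that contains \<open>z\<close>,
      with \<open>F r\<close> as the exceptional set.\<close>
    obtain r where r: "r < 1" "z \<in> ball 0 r" using radius [OF z] by blast
    show ?thesis
    proof (intro exI conjI)
      show "z \<in> ball 0 r" by (fact r(2))
      show "ball 0 r \<subseteq> ball (0 :: complex) 1" using r(1) by auto
      show "finite (F r)" by (rule F [OF r(1)])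
      show "F r \<subseteq> \<Gamma>" by (auto simp: F_def)
      show "\<forall>\<gamma>\<in>\<Gamma> - F r. \<forall>w\<in>psu11_act \<gamma> ` ball 0 r. \<phi> w = 0"
        using \<psi>_F by (auto simp: \<phi>_def)
    qed simp
  qed
  moreover have "((\<lambda>\<gamma>. \<phi> (psu11_act \<gamma> z)) has_sum 1) \<Gamma>" if z: "z \<in> ball 0 1" for z
  proof -
    \<comment> \<open>By invariance the denominator of \<phi> has the same value \<Phi> z at every
      point of the orbit, so it factors out of the sum.\<close>
    have "((\<lambda>\<gamma>. \<psi> (psu11_act \<gamma> z) * inverse (\<Phi> z)) has_sum (\<Phi> z * inverse (\<Phi> z))) \<Gamma>"
      by (rule has_sum_cmult_left [OF \<Phi>_sum [OF z]])
    then have "((\<lambda>\<gamma>. \<psi> (psu11_act \<gamma> z) * inverse (\<Phi> z)) has_sum 1) \<Gamma>"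
      using \<Phi>_pos [OF z] by simp
    then show ?thesis
      by (rule has_sum_cong [THEN iffD1, rotated]) (simp only: \<phi>_def \<Phi>_invariant [OF z])
  qed
  ultimately show ?thesis by blast
qed

end
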